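(* Let $P$ be a metrical task system problem and let $A$ be a deterministic online algorithm for $P$ that is $\alpha$-competitive. Then there is a deterministic prediction-based online algorithm for $P$ whose competitive ratio against any offline algorithm $\textsc{Off}$ is at most \[9\cdot\min\{\alpha,\;1+4\eta/\textsc{Off}\},\] where $\eta$ is the prediction error with respect to $\textsc{Off}$ and (abusing notation) $\textsc{Off}$ also denotes the cost of that offline algorithm on the input.
   Context: A metrical task system (MTS) is given by a metric space $(M,\mathit{dist})$ of states and an initial state $x_0\in M$. At each time $t=1,2,\dots,T$ a cost function $\ell_t\colon M\to\mathbb{R}_{\ge0}\cup\{+\infty\}$ arrives. The algorithm, without knowledge of future cost functions (but after seeing $\ell_t$), chooses a state $x_t$ and pays $\mathit{dist}(x_{t-1},x_t)+\ell_t(x_t)$. The goal is to minimize the total cost. A prediction-based algorithm additionally receives at each time $t$, together with $\ell_t$, a predicted state $p_t\in M$. For an offline algorithm $\textsc{Off}$ with states $o_1,\dots,o_T$, the prediction error is $\eta=\sum_{t=1}^T\mathit{dist}(p_t,o_t)$. An algorithm $\mathcal{A}$ is $r$-competitive (has competitive ratio $r$) against an algorithm $B$ if there is a constant $c$ independent of the input such that for every input $I$, $\mathbb{E}[\mathrm{cost}(\mathcal{A}(I))]\le r\cdot \mathrm{cost}(B(I))+c$ (the expectation is over the algorithm's randomness; $r$ may depend on instance quantities such as $\eta$ and $\textsc{Off}$). An online algorithm is $\alpha$-competitive if it is $\alpha$-competitive against an optimal offline solution. *)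

theory Defs
  imports "HOL-Analysis.Analysis"
begin

text \<open>
  The metric space of states is a type of class \<open>metric_space\<close>. A metrical task system problem on it
  consists of an initial state and a set of admissible inputs, an input being the finite sequence of
  arriving cost functions; the value set of the cost functions is \<open>ennreal\<close>. Taking all
  sequences as admissible gives the unrestricted problem, and smaller sets give special cases such
  as paging.
\<close>

type_synonym 'a cost_fun = "'a \<Rightarrow> ennreal"

definition mts_cost :: "'a::metric_space \<Rightarrow> 'a cost_fun list \<Rightarrow> 'a list \<Rightarrow> ennreal" where
  "mts_cost x\<^sub>0 ls xs =
     (\<Sum>t<length ls. ennreal (dist ((x\<^sub>0 # xs) ! t) (xs ! t)) + (ls ! t) (xs ! t))"

text \<open>
  A deterministic online algorithm maps the nonempty history of everything received so far,
  including the current item, to the next state. The items are cost functions in the classical case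
  and pairs of a cost function and a predicted state in the prediction-based case.
\<close>

type_synonym ('i, 'a) online_alg = "'i list \<Rightarrow> 'a"

definition online_run :: "('i, 'a) online_alg \<Rightarrow> 'i list \<Rightarrow> 'a list" where
  "online_run A is = map (\<lambda>t. A (take (Suc t) is)) [0..<length is]"

text \<open>
  An offline algorithm sees the whole input. With items that carry predictions it may look at those
  as well; algorithms that ignore them are a special case.
\<close>

type_synonym ('i, 'a) offline_alg = "'i list \<Rightarrow> 'a list"

definition is_offline_alg :: "('i, 'a) offline_alg \<Rightarrow> bool" where
  "is_offline_alg F \<longleftrightarrow> (\<forall>is. length (F is) = length is)"

definition opt_cost :: "'a::metric_space \<Rightarrow> 'a cost_fun list \<Rightarrow> ennreal" where
  "opt_cost x\<^sub>0 ls = (INF xs\<in>{xs. length xs = length ls}. mts_cost x\<^sub>0 ls xs)"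

definition prediction_error :: "'a::metric_space list \<Rightarrow> 'a list \<Rightarrow> ennreal" where
  "prediction_error ps os = (\<Sum>t<length ps. ennreal (dist (ps ! t) (os ! t)))"

text \<open>
  \<open>competitive_on S r a b\<close>: on the inputs in \<open>S\<close>, an algorithm of cost \<open>a\<close> is \<open>r\<close>-competitive
  against one of cost \<open>b\<close>. The ratio may depend on the input, the additive constant may not.
\<close>

definition competitive_on ::
  "'x set \<Rightarrow> ('x \<Rightarrow> ennreal) \<Rightarrow> ('x \<Rightarrow> ennreal) \<Rightarrow> ('x \<Rightarrow> ennreal) \<Rightarrow> bool" where
  "competitive_on S r a b \<longleftrightarrow> (\<exists>c::real. c \<ge> 0 \<and> (\<forall>x\<in>S. a x \<le> r x * b x + ennreal c))"

definition online_competitive ::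
  "'a::metric_space \<Rightarrow> 'a cost_fun list set \<Rightarrow> ('a cost_fun, 'a) online_alg \<Rightarrow> ennreal \<Rightarrow> bool" where
  "online_competitive x\<^sub>0 S A \<alpha> \<longleftrightarrow>
     competitive_on S (\<lambda>_. \<alpha>) (\<lambda>ls. mts_cost x\<^sub>0 ls (online_run A ls)) (opt_cost x\<^sub>0)"

text \<open>Only the cost functions are restricted to be admissible; the predictions are arbitrary.\<close>

definition predicted_inputs :: "'a cost_fun list set \<Rightarrow> ('a cost_fun \<times> 'a) list set" where
  "predicted_inputs S = {is. map fst is \<in> S}"

end

theory Submission
  imports Defs
begin

text \<open>
  Moving to a state \<open>x\<close> that nearly minimizes \<open>\<ell>\<^sub>t(x) + 2 dist(x, p\<^sub>t)\<close> costs at most \<open>Off + 4\<eta> + 1\<close>: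
  one walks from prediction to prediction, with a detour to \<open>x\<close> and back that is no more expensive
  than the detour to the state of \<open>Off\<close>.

  To combine this algorithm with \<open>A\<close>, follow the one selected by the parity of the least \<open>k\<close> for which
  its cost so far is at most \<open>2^k\<close>. When \<open>k\<close> increases, the switch goes through \<open>x\<^sub>0\<close>, so the total cost
  is at most \<open>2 * 2^k\<close> plus the cost of the algorithm being followed. For \<open>k \<ge> 2\<close> minimality of \<open>k\<close> says
  that this algorithm has cost more than \<open>2^(k-2)\<close> and the other one more than \<open>2^(k-1)\<close>. This gives
  the factor \<open>8 + 1\<close> against the former and \<open>6\<close> against the latter.
\<close>

section \<open>Appending one item to runs, costs and prediction errors\<close>

lemma length_online_run [simp]: "length (online_run A xs) = length xs"
  by (simp add: online_run_def)

lemma online_run_Nil [simp]: "online_run A [] = []"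
  by (simp add: online_run_def)

lemma online_run_snoc [simp]: "online_run A (xs @ [x]) = online_run A xs @ [A (xs @ [x])]"
  by (simp add: online_run_def)

lemma online_run_map: "online_run (\<lambda>xs. A (map f xs)) xs = online_run A (map f xs)"
  by (simp add: online_run_def take_map)

lemma mts_cost_Nil [simp]: "mts_cost x\<^sub>0 [] xs = 0"
  by (simp add: mts_cost_def)

lemma mts_cost_snoc:
  assumes "length xs = length ls"
  shows "mts_cost x\<^sub>0 (ls @ [l]) (xs @ [x]) =
    mts_cost x\<^sub>0 ls xs + (ennreal (dist (last (x\<^sub>0 # xs)) x) + l x)"
proof -
  \<comment> \<open>Entry \<open>t\<close> of the list headed by \<open>x\<^sub>0\<close> is the
    position before step \<open>t\<close>, so \<open>t = length xs\<close> is included: it is the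
    origin of the appended move.\<close>
  have "(x\<^sub>0 # xs @ [x]) ! t = (x\<^sub>0 # xs) ! t" if "t \<le> length xs" for t
    using that by (cases t) (auto simp: nth_append)
  moreover have "(x\<^sub>0 # xs) ! length xs = last (x\<^sub>0 # xs)"
    by (simp add: last_conv_nth nth_Cons split: nat.split)
  ultimately show ?thesis
    using assms by (auto simp: mts_cost_def nth_append intro!: sum.cong)
qed

lemma prediction_error_Nil [simp]: "prediction_error [] os = 0"
  by (simp add: prediction_error_def)

lemma prediction_error_snoc:
  assumes "length os = length ps"
  shows "prediction_error (ps @ [p]) (os @ [o']) = prediction_error ps os + ennreal (dist p o')"
  using assms by (auto simp: prediction_error_def nth_append intro!: sum.cong)

text \<open>By the triangle inequality, movement alone covers this distance. It pays for the detour
  through \<open>x\<^sub>0\<close> at a switch.\<close>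

lemma dist_last_le_mts_cost:
  assumes "length xs = length ls"
  shows "ennreal (dist x\<^sub>0 (last (x\<^sub>0 # xs))) \<le> mts_cost x\<^sub>0 ls xs"
  using assms
proof (induction xs arbitrary: ls rule: rev_induct)
  case Nil
  then show ?case by simp
next
  case (snoc x xs)
  then obtain ls' l where ls: "ls = ls' @ [l]" "length xs = length ls'"
    by (cases ls rule: rev_cases) auto
  have "ennreal (dist x\<^sub>0 x) \<le> ennreal (dist x\<^sub>0 (last (x\<^sub>0 # xs))) + ennreal (dist (last (x\<^sub>0 # xs)) x)"
    by (simp add: dist_triangle flip: ennreal_plus)
  also have "\<dots> \<le> mts_cost x\<^sub>0 ls' xs + (ennreal (dist (last (x\<^sub>0 # xs)) x) + l x)"
    by (intro add_mono snoc.IH ls) simp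
  finally show ?case
    using ls by (simp add: mts_cost_snoc)
qed

lemma opt_cost_le: "length xs = length ls \<Longrightarrow> opt_cost x\<^sub>0 ls \<le> mts_cost x\<^sub>0 ls xs"
  unfolding opt_cost_def by (rule INF_lower) simp


section \<open>Following the prediction\<close>

text \<open>If the infimum is infinite, all values are top and any point works; a finite infimum
  grows strictly when \<open>e\<close> is added, so some value lies below the sum.\<close>

lemma ex_approx_minimizer:
  fixes f :: "'a \<Rightarrow> ennreal"
  assumes "e > 0"
  shows "\<exists>x. \<forall>y. f x \<le> f y + e"
proof (cases "(INF y. f y) = \<infinity>")
  case True
  then have "f y = top" for y
    using INF_lower[of y UNIV f] by (simp add: top_unique)
  then show ?thesis by simp
next
  case False
  then have "(INF y. f y) < (INF y. f y) + e"
    using assms ennreal_add_left_cancel_less[of "INF y. f y" 0 e] by simp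
  then obtain x where "f x < (INF y. f y) + e"
    by (auto simp: INF_less_iff)
  moreover have "(INF y. f y) + e \<le> f y + e" for y
    by (intro add_mono INF_lower) auto
  ultimately show ?thesis
    by (meson less_imp_le order_trans)
qed

text \<open>A minimizer need not exist; the summable slack of \<open>1/2^t\<close> only costs an additive constant.\<close>

definition follow_prediction :: "('a::metric_space cost_fun \<times> 'a, 'a) online_alg" where
  "follow_prediction is = (case last is of (l, p) \<Rightarrow>
     SOME x. \<forall>y. l x + ennreal (2 * dist x p) \<le> l y + ennreal (2 * dist y p) + ennreal ((1/2) ^ length is))"

lemma follow_prediction_snoc:
  fixes l :: "'a::metric_space cost_fun" and "is" :: "('a cost_fun \<times> 'a) list" and p :: 'a
  defines "x \<equiv> follow_prediction (is @ [(l, p)])"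
  shows "l x + ennreal (2 * dist x p) \<le> l y + ennreal (2 * dist y p) + ennreal ((1/2) ^ Suc (length is))"
proof -
  have "\<exists>x. \<forall>y. l x + ennreal (2 * dist x p) \<le> l y + ennreal (2 * dist y p) + ennreal ((1/2) ^ Suc (length is))"
    by (rule ex_approx_minimizer) simp
  from someI_ex[OF this] show ?thesis
    by (simp add: x_def follow_prediction_def)
qed

text \<open>One step of a potential argument: \<open>f\<close>, \<open>p\<close>, \<open>q\<close>
  are the old positions of the follower, the prediction and the offline solution, and primes mark
  the new ones. The slack halves from \<open>2 * e\<close> to \<open>e\<close>, and the released
  \<open>e\<close> pays for the inexact minimization.\<close>

lemma follow_prediction_step:
  fixes c r lf lo :: ennreal and f f' p p' q q' :: "'a::metric_space"
  assumes IH: "c + ennreal (dist f p + dist p q + 2 * e) \<le> r"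
    and opt: "lf + ennreal (2 * dist f' p') \<le> lo + ennreal (2 * dist q' p') + ennreal e"
    and e: "e \<ge> 0"
  shows "c + (ennreal (dist f f') + lf) + ennreal (dist f' p' + dist p' q' + e)
    \<le> r + (ennreal (dist q q') + lo) + 4 * ennreal (dist p' q')"
proof (cases "r = \<infinity> \<or> lo = \<infinity>")
  case True
  then show ?thesis by auto
next
  case False
  then have "r \<noteq> top" "lo \<noteq> top" by auto
  moreover from this have "c \<noteq> top" "lf \<noteq> top"
    using IH opt by (auto simp: top_unique)
  ultimately obtain r' lo' c' lf' where
    eqs: "r = ennreal r'" "lo = ennreal lo'" "c = ennreal c'" "lf = ennreal lf'"
    and nn: "r' \<ge> 0" "lo' \<ge> 0" "c' \<ge> 0" "lf' \<ge> 0"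
    by (metis ennreal_cases)
  have 1: "c' + (dist f p + dist p q + 2 * e) \<le> r'"
    using IH nn e by (simp add: eqs flip: ennreal_plus)
  have 2: "lf' + 2 * dist f' p' \<le> lo' + 2 * dist q' p' + e"
    using opt nn e by (simp add: eqs flip: ennreal_plus)
  \<comment> \<open>The factor 4 counts \<open>dist p' q'\<close> twice for the offline detour in
    the minimization, once for comparing \<open>dist p p'\<close> with the offline move, and once
    for the new potential.\<close>
  have 3: "dist f f' \<le> dist f p + dist p p' + dist f' p'"
    by metric
  have 4: "dist p p' \<le> dist p q + dist q q' + dist p' q'"
    by metric
  have "c' + (dist f f' + lf') + (dist f' p' + dist p' q' + e)
      \<le> r' + (dist q q' + lo') + 4 * dist p' q'"
    using 1 2 3 4 by (simp add: dist_commute)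
  moreover have "4 * ennreal (dist p' q') = ennreal (4 * dist p' q')"
    by (simp add: ennreal_mult)
  ultimately show ?thesis
    using nn e by (simp add: eqs flip: ennreal_plus)
qed

text \<open>The potential consists of the walk back to the last prediction, the distance from there
  to the offline state, and the unspent slack, whose initial value is the constant 1.\<close>

lemma follow_prediction_invariant:
  assumes "length os = length is"
  shows "mts_cost x\<^sub>0 (map fst is) (online_run follow_prediction is)
    + ennreal (dist (last (x\<^sub>0 # online_run follow_prediction is)) (last (x\<^sub>0 # map snd is))
      + dist (last (x\<^sub>0 # map snd is)) (last (x\<^sub>0 # os)) + (1/2) ^ length is)
    \<le> mts_cost x\<^sub>0 (map fst is) os + 4 * prediction_error (map snd is) os + 1"
  using assms
proof (induction "is" arbitrary: os rule: rev_induct)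
  case Nil
  then show ?case by simp
next
  case (snoc i "is")
  obtain l p where i: "i = (l, p)" by fastforce
  from snoc.prems obtain qs q where os: "os = qs @ [q]" "length qs = length is"
    by (cases os rule: rev_cases) auto
  \<comment> \<open>The slack is rewritten as twice its next value, the form
    \<open>follow_prediction_step\<close> expects.\<close>
  have "mts_cost x\<^sub>0 (map fst is) (online_run follow_prediction is)
      + ennreal (dist (last (x\<^sub>0 # online_run follow_prediction is)) (last (x\<^sub>0 # map snd is))
        + dist (last (x\<^sub>0 # map snd is)) (last (x\<^sub>0 # qs)) + 2 * (1/2) ^ Suc (length is))
    \<le> mts_cost x\<^sub>0 (map fst is) qs + 4 * prediction_error (map snd is) qs + 1"
    using snoc.IH[OF os(2)] by simp
  from follow_prediction_step[OF this follow_prediction_snoc[of l "is" p q]]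
  show ?case
    using os by (simp add: i mts_cost_snoc prediction_error_snoc distrib_left ac_simps)
qed

lemma follow_prediction_cost:
  assumes "length os = length is"
  shows "mts_cost x\<^sub>0 (map fst is) (online_run follow_prediction is)
    \<le> mts_cost x\<^sub>0 (map fst is) os + 4 * prediction_error (map snd is) os + 1"
  using follow_prediction_invariant[OF assms, of x\<^sub>0]
  by (rule order_trans[rotated]) simp


section \<open>Combining two online algorithms\<close>

text \<open>If both costs are infinite, no \<open>k\<close> qualifies and the value is unspecified;
  hence the assumption \<open>min a b < \<infinity>\<close> wherever the bound has to be
  attained.\<close>

definition phase :: "ennreal \<Rightarrow> ennreal \<Rightarrow> nat" where
  "phase a b = (LEAST k. (if even k then a else b) \<le> 2 ^ k)"

lemma ex_phase:
  assumes "min a b < (\<infinity>::ennreal)"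
  shows "\<exists>k. (if even k then a else b) \<le> 2 ^ k"
proof -
  \<comment> \<open>Exponents of both parities are provided, because either cost may be the finite
    one.\<close>
  have bound: "\<exists>n. x \<le> 2 ^ (2 * n) \<and> x \<le> 2 ^ Suc (2 * n)" if "x < \<infinity>" for x :: ennreal
  proof -
    from that obtain r where r: "x = ennreal r" "r \<ge> 0"
      by (auto simp: less_top_ennreal)
    obtain n where n: "r < 2 ^ n"
      using real_arch_pow[of 2 r] by auto
    have "r \<le> 2 ^ m" if "n \<le> m" for m
      using n power_increasing[OF that, of "2::real"] by linarith
    then have "x \<le> 2 ^ m" if "n \<le> m" for m
      using that r by (metis ennreal_leI ennreal_numeral ennreal_power zero_le_numeral)
    from this[of "2 * n"] this[of "Suc (2 * n)"] show ?thesis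
      by auto
  qed
  show ?thesis
  proof (cases "a < \<infinity>")
    case True
    from bound[OF this] show ?thesis by (metis even_mult_iff even_numeral)
  next
    case False
    with assms have "b < \<infinity>" by (auto simp: min_def split: if_splits)
    from bound[OF this] show ?thesis by (metis even_Suc even_mult_iff even_numeral)
  qed
qed

lemma phase_le: "min a b < \<infinity> \<Longrightarrow> (if even (phase a b) then a else b) \<le> 2 ^ phase a b"
  unfolding phase_def by (rule LeastI_ex[OF ex_phase])

lemma less_phase: "k < phase a b \<Longrightarrow> 2 ^ k < (if even k then a else b)"
  unfolding phase_def using not_less_Least by fastforce

text \<open>Any \<open>k\<close> that qualifies for the larger costs also qualifies for the smaller
  ones.\<close>

lemma phase_mono:
  assumes "a \<le> a'" "b \<le> b'" "min a' b' < \<infinity>"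
  shows "phase a b \<le> phase a' b'"
  unfolding phase_def[of a b]
  using phase_le[OF assms(3)] assms(1,2) by (intro Least_le) (auto split: if_splits)

text \<open>Both runs are recomputed from the history, current item included, so the choice is
  online. The projection \<open>f\<close> lets items carry predictions besides the cost
  function.\<close>

definition combine ::
  "'a::metric_space \<Rightarrow> ('i \<Rightarrow> 'a cost_fun) \<Rightarrow> ('i, 'a) online_alg \<Rightarrow> ('i, 'a) online_alg \<Rightarrow> ('i, 'a) online_alg" where
  "combine x\<^sub>0 f A B is =
    (if even (phase (mts_cost x\<^sub>0 (map f is) (online_run A is)) (mts_cost x\<^sub>0 (map f is) (online_run B is)))
     then A is else B is)"

text \<open>Here \<open>u\<close> and \<open>u'\<close> are the positions of the abandoned and the
  newly followed algorithm, and \<open>w\<close> is the latter's next state. The route through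
  \<open>x\<^sub>0\<close> and \<open>u'\<close> adds at most \<open>2 ^ k + d\<close> to the
  followed step; with \<open>v \<le> 3 * 2 ^ k\<close> this makes
  \<open>4 * 2 ^ k \<le> 2 * 2 ^ k'\<close>, plus \<open>d\<close>.\<close>

lemma switch_cost:
  fixes v c d l :: ennreal and u u' w :: "'a::metric_space"
  assumes v: "v \<le> 2 * 2 ^ k + c" and c: "c \<le> 2 ^ k" and kk: "k < k'"
    and u: "ennreal (dist x\<^sub>0 u) \<le> c" and u': "ennreal (dist x\<^sub>0 u') \<le> d"
  shows "v + (ennreal (dist u w) + l) \<le> 2 * 2 ^ k' + (d + (ennreal (dist u' w) + l))"
proof -
  have "dist u w \<le> dist x\<^sub>0 u + dist x\<^sub>0 u' + dist u' w"
    by metric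
  then have "ennreal (dist u w) \<le> ennreal (dist x\<^sub>0 u) + ennreal (dist x\<^sub>0 u') + ennreal (dist u' w)"
    by (simp add: ennreal_leI flip: ennreal_plus)
  also have "\<dots> \<le> 2 ^ k + d + ennreal (dist u' w)"
    using u u' c by (intro add_mono) auto
  finally have "v + (ennreal (dist u w) + l) \<le> (2 * 2 ^ k + 2 ^ k) + ((2 ^ k + d + ennreal (dist u' w)) + l)"
    using v c by (intro add_mono order_trans[OF v]) auto
  also have "\<dots> = 2 * 2 ^ Suc k + (d + (ennreal (dist u' w) + l))"
  proof -
    have "(2 * z + z) + ((z + d + e) + l) = 2 * (2 * z) + (d + (e + l))" for z e :: ennreal
      by (simp only: mult_2 distrib_left add_ac)
    then show ?thesis by (simp only: power_Suc)
  qed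
  also have "\<dots> \<le> 2 * 2 ^ k' + (d + (ennreal (dist u' w) + l))"
    using kk by (intro add_mono mult_left_mono power_increasing) auto
  finally show ?thesis .
qed

text \<open>Induction on the input. With unchanged parity the move of the followed algorithm is
  copied and the bound only relaxes; a change of parity forces \<open>k < k'\<close>, and the growth
  of the power pays for the switch.\<close>

lemma combine_cost_phase:
  fixes x\<^sub>0 :: "'a::metric_space" and f :: "'i \<Rightarrow> 'a cost_fun" and A B :: "('i, 'a) online_alg"
  defines "a \<equiv> \<lambda>is. mts_cost x\<^sub>0 (map f is) (online_run A is)"
    and "b \<equiv> \<lambda>is. mts_cost x\<^sub>0 (map f is) (online_run B is)"
  assumes "min (a is) (b is) < \<infinity>"
  shows "mts_cost x\<^sub>0 (map f is) (online_run (combine x\<^sub>0 f A B) is)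
    \<le> 2 * 2 ^ phase (a is) (b is) + (if even (phase (a is) (b is)) then a is else b is)"
  using assms(3)
proof (induction "is" rule: rev_induct)
  case Nil
  then show ?case by simp
next
  case (snoc i "is")
  let ?C = "combine x\<^sub>0 f A B"
  define k where "k = phase (a is) (b is)"
  define k' where "k' = phase (a (is @ [i])) (b (is @ [i]))"
  have a: "a (is @ [i]) = a is + (ennreal (dist (last (x\<^sub>0 # online_run A is)) (A (is @ [i]))) + f i (A (is @ [i])))"
    and b: "b (is @ [i]) = b is + (ennreal (dist (last (x\<^sub>0 # online_run B is)) (B (is @ [i]))) + f i (B (is @ [i])))"
    by (simp_all add: a_def b_def mts_cost_snoc)
  have C: "mts_cost x\<^sub>0 (map f (is @ [i])) (online_run ?C (is @ [i])) = mts_cost x\<^sub>0 (map f is) (online_run ?C is)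
      + (ennreal (dist (last (x\<^sub>0 # online_run ?C is)) (?C (is @ [i]))) + f i (?C (is @ [i])))"
    by (simp add: mts_cost_snoc)
  have mono: "a is \<le> a (is @ [i])" "b is \<le> b (is @ [i])"
    unfolding a b by simp_all
  then have fin: "min (a is) (b is) < \<infinity>"
    using snoc.prems by (auto simp: min_def split: if_splits)
  note IH = snoc.IH[OF fin, folded k_def]
  have kk: "k \<le> k'"
    unfolding k_def k'_def using mono snoc.prems by (rule phase_mono)
  have pk: "(if even k then a is else b is) \<le> 2 ^ k"
    unfolding k_def using fin by (rule phase_le)
  \<comment> \<open>The last state was selected by the phase of this very prefix; before the first
    item every run is at \<open>x\<^sub>0\<close>.\<close>
  have lastC: "last (x\<^sub>0 # online_run ?C is) = last (x\<^sub>0 # online_run (if even k then A else B) is)"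
    by (cases "is" rule: rev_cases) (auto simp: combine_def a_def b_def k_def)
  have stateC: "?C (is @ [i]) = (if even k' then A (is @ [i]) else B (is @ [i]))"
    by (simp add: combine_def a_def b_def k'_def)
  have da: "ennreal (dist x\<^sub>0 (last (x\<^sub>0 # online_run A is))) \<le> a is"
    and db: "ennreal (dist x\<^sub>0 (last (x\<^sub>0 # online_run B is))) \<le> b is"
    unfolding a_def b_def by (rule dist_last_le_mts_cost; simp)+
  have pow: "(2::ennreal) * 2 ^ k \<le> 2 * 2 ^ k'"
    using kk by (intro mult_left_mono power_increasing) auto
  have "mts_cost x\<^sub>0 (map f (is @ [i])) (online_run ?C (is @ [i]))
      \<le> 2 * 2 ^ k' + (if even k' then a (is @ [i]) else b (is @ [i]))"
  proof (cases "even k = even k'")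
    case True
    have "mts_cost x\<^sub>0 (map f is) (online_run ?C is) + y
        \<le> 2 * 2 ^ k' + ((if even k then a is else b is) + y)" for y
      using add_right_mono[OF order_trans[OF IH add_right_mono[OF pow]], of y] by (simp only: add.assoc)
    then show ?thesis
      using True unfolding C lastC stateC a b by (cases "even k") (simp_all only: if_True if_False)
  next
    case False
    then have "k < k'" using kk by (metis le_neq_implies_less)
    show ?thesis
    proof (cases "even k")
      case True
      with False have "odd k'" by simp
      with True \<open>k < k'\<close> IH pk da db show ?thesis
        unfolding C lastC stateC b by (simp only: if_True if_False switch_cost)
    next
      case odd: False
      with False have "even k'" by simp
      with odd \<open>k < k'\<close> IH pk da db show ?thesis
        unfolding C lastC stateC a by (simp only: if_True if_False switch_cost)
    qed
  qed
  then show ?case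
    by (simp only: k'_def)
qed

lemma combine_cost:
  fixes x\<^sub>0 :: "'a::metric_space"
  shows "mts_cost x\<^sub>0 (map f is) (online_run (combine x\<^sub>0 f A B) is)
    \<le> 9 * min (mts_cost x\<^sub>0 (map f is) (online_run A is)) (mts_cost x\<^sub>0 (map f is) (online_run B is)) + 6"
proof -
  define a where "a = mts_cost x\<^sub>0 (map f is) (online_run A is)"
  define b where "b = mts_cost x\<^sub>0 (map f is) (online_run B is)"
  define v where "v = mts_cost x\<^sub>0 (map f is) (online_run (combine x\<^sub>0 f A B) is)"
  define k where "k = phase a b"
  define c where "c = (if even k then a else b)"
  define d where "d = (if even k then b else a)"
  have "v \<le> 9 * min a b + 6"
  proof (cases "min a b < \<infinity>")
    case False
    then have "min a b = \<infinity>" by (metis infinity_ennreal_def less_top)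
    then show ?thesis by (simp add: ennreal_mult_top)
  next
    case fin: True
    have v: "v \<le> 2 * 2 ^ k + c"
      unfolding v_def a_def b_def c_def k_def
      by (rule combine_cost_phase) (use fin in \<open>simp only: a_def b_def\<close>)
    have c: "c \<le> 2 ^ k"
      using phase_le[OF fin] by (simp add: c_def k_def)
    have min: "min a b = min c d"
      by (simp add: c_def d_def min.commute)
    show ?thesis
    proof (cases "k \<ge> 2")
      case False
      \<comment> \<open>For \<open>k \<le> 1\<close> nothing is charged to the costs: the additive
        constant is \<open>3 * 2 ^ 1 = 6\<close>.\<close>
      have "v \<le> 2 * 2 ^ k + 2 ^ k"
        using v c by (meson add_left_mono order_trans)
      also have "\<dots> = 3 * 2 ^ k"
        using distrib_right[of 2 1 "2 ^ k :: ennreal"] by simp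
      also have "\<dots> \<le> 3 * 2 ^ 1"
        using False by (intro mult_left_mono power_increasing) auto
      finally show ?thesis
        by (simp add: add_increasing)
    next
      case True
      then obtain j where k: "k = Suc (Suc j)"
        by (metis add_2_eq_Suc le_Suc_ex)
      \<comment> \<open>\<open>j\<close> has the parity of \<open>k\<close>, so its failure bounds
        the followed cost \<open>c\<close> from below; \<open>Suc j\<close> has the other parity and
        bounds \<open>d\<close>.\<close>
      have cj: "2 ^ j \<le> c"
        using less_phase[of j a b] by (simp add: c_def k_def[symmetric] k)
      have dj: "2 ^ Suc j \<le> d"
        using less_phase[of "Suc j" a b] by (auto simp: d_def k_def[symmetric] k split: if_splits)
      have "v \<le> 9 * c"
      proof -
        have "v \<le> 8 * 2 ^ j + c" using v by (simp add: k)
        also have "\<dots> \<le> 8 * c + c" using cj by (intro add_mono mult_left_mono) auto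
        also have "\<dots> = 9 * c" using distrib_right[of 8 1 c] by simp
        finally show ?thesis .
      qed
      moreover have "v \<le> 9 * d"
      proof -
        have "v \<le> 2 * 2 ^ k + 2 ^ k"
          using v c by (meson add_left_mono order_trans)
        also have "\<dots> = 6 * 2 ^ Suc j" by (simp add: k distrib_right[symmetric])
        also have "\<dots> \<le> 9 * d" using dj by (intro mult_mono) auto
        finally show ?thesis .
      qed
      ultimately have "v \<le> 9 * min c d"
        by (simp add: min_def)
      then show ?thesis
        unfolding min by (simp add: add_increasing2)
    qed
  qed
  then show ?thesis by (simp add: a_def b_def v_def)
qed

section \<open>Competitive ratio of the combined algorithm\<close>

theorem theorem1:
  fixes x\<^sub>0 :: "'a::metric_space"
    and S :: "'a cost_fun list set"
    and A :: "('a cost_fun, 'a) online_alg"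
    and \<alpha> :: ennreal
  assumes "online_competitive x\<^sub>0 S A \<alpha>"
  shows "\<exists>B :: ('a cost_fun \<times> 'a, 'a) online_alg.
    \<forall>Off :: ('a cost_fun \<times> 'a, 'a) offline_alg. is_offline_alg Off \<longrightarrow>
      competitive_on (predicted_inputs S)
        (\<lambda>is. 9 * min \<alpha> (1 + 4 * prediction_error (map snd is) (Off is)
                               / mts_cost x\<^sub>0 (map fst is) (Off is)))
        (\<lambda>is. mts_cost x\<^sub>0 (map fst is) (online_run B is))
        (\<lambda>is. mts_cost x\<^sub>0 (map fst is) (Off is))"
proof -
  from assms obtain c :: real where c: "c \<ge> 0"
    and A: "\<And>ls. ls \<in> S \<Longrightarrow> mts_cost x\<^sub>0 ls (online_run A ls) \<le> \<alpha> * opt_cost x\<^sub>0 ls + ennreal c"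
    unfolding online_competitive_def competitive_on_def by blast
  define B where "B = combine x\<^sub>0 fst (\<lambda>is. A (map fst is)) follow_prediction"
  have "mts_cost x\<^sub>0 (map fst is) (online_run B is)
      \<le> 9 * min \<alpha> (1 + 4 * prediction_error (map snd is) (Off is) / mts_cost x\<^sub>0 (map fst is) (Off is))
          * mts_cost x\<^sub>0 (map fst is) (Off is) + ennreal (9 * (c + 1) + 6)"
    if Off: "is_offline_alg Off" and S: "is \<in> predicted_inputs S"
    for Off :: "('a cost_fun \<times> 'a, 'a) offline_alg" and "is"
  proof -
    define a where "a = mts_cost x\<^sub>0 (map fst is) (online_run A (map fst is))"
    define b where "b = mts_cost x\<^sub>0 (map fst is) (online_run follow_prediction is)"
    define off where "off = mts_cost x\<^sub>0 (map fst is) (Off is)"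
    define \<eta> where "\<eta> = prediction_error (map snd is) (Off is)"
    have len: "length (Off is) = length is"
      using Off by (simp add: is_offline_alg_def)
    have "a \<le> \<alpha> * opt_cost x\<^sub>0 (map fst is) + ennreal c"
      using A S by (simp add: a_def predicted_inputs_def)
    also have "\<dots> \<le> \<alpha> * off + ennreal c"
      unfolding off_def using len by (intro add_mono mult_left_mono opt_cost_le) auto
    finally have a: "a \<le> \<alpha> * off + ennreal c" .
    have b: "b \<le> off + 4 * \<eta> + 1"
      unfolding b_def off_def \<eta>_def using len by (rule follow_prediction_cost)
    \<comment> \<open>\<open>c + 1\<close> covers the constant \<open>c\<close> of \<open>A\<close>
      as well as the 1 of \<open>follow_prediction\<close>; the factor 9 and the summand 6 of
      \<open>combine_cost\<close> are applied afterwards.\<close>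
    have "min a b \<le> min \<alpha> (1 + 4 * \<eta> / off) * off + ennreal (c + 1)"
    \<comment> \<open>For \<open>off = 0\<close> the product with the ratio is 0 whatever the
      quotient, so it cannot absorb the error in the bound on \<open>b\<close>; the bound on
      \<open>a\<close> is then just \<open>c\<close>.\<close>
    proof (cases "\<alpha> \<le> 1 + 4 * \<eta> / off \<or> off = 0")
      case True
      then have "a \<le> min \<alpha> (1 + 4 * \<eta> / off) * off + ennreal c"
        using a by (auto simp: min_absorb1)
      also have "\<dots> \<le> min \<alpha> (1 + 4 * \<eta> / off) * off + ennreal (c + 1)"
        by (intro add_left_mono ennreal_leI) simp
      finally show ?thesis by (simp add: min.coboundedI1)
    next
      case False
      have "off + 4 * \<eta> \<le> (1 + 4 * \<eta> / off) * off"
      proof (cases "off = \<infinity>")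
        case True
        then show ?thesis by (simp add: ennreal_mult_top)
      next
        case fin: False
        then have "4 * \<eta> / off * off = 4 * \<eta>"
          using False by (simp add: ennreal_divide_times ennreal_mult_divide_eq top.not_eq_extremum)
        then show ?thesis by (simp add: distrib_right)
      qed
      then have "b \<le> (1 + 4 * \<eta> / off) * off + ennreal (c + 1)"
        using c by (intro order_trans[OF b] add_mono) auto
      moreover have "min \<alpha> (1 + 4 * \<eta> / off) = 1 + 4 * \<eta> / off"
        using False by (simp add: min_def)
      ultimately show ?thesis by (simp add: min.coboundedI2)
    qed
    then have "9 * min a b + 6 \<le> 9 * (min \<alpha> (1 + 4 * \<eta> / off) * off + ennreal (c + 1)) + 6"
      by (intro add_right_mono mult_left_mono) auto
    also have "\<dots> = 9 * min \<alpha> (1 + 4 * \<eta> / off) * off + ennreal (9 * (c + 1) + 6)"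
    proof -
      have "ennreal (9 * (c + 1) + 6) = ennreal 9 * ennreal (c + 1) + ennreal 6"
        using c by (subst ennreal_mult[symmetric]) (auto simp del: ennreal_numeral simp flip: ennreal_plus)
      then show ?thesis by (simp add: distrib_left mult.assoc add.assoc)
    qed
    finally have "9 * min a b + 6 \<le> \<dots>" .
    moreover have "mts_cost x\<^sub>0 (map fst is) (online_run B is) \<le> 9 * min a b + 6"
      using combine_cost[of x\<^sub>0 fst "is" "\<lambda>is. A (map fst is)" follow_prediction]
      by (simp add: B_def a_def b_def online_run_map)
    ultimately show ?thesis
      unfolding off_def \<eta>_def by (rule order_trans[rotated])
  qed
  moreover have "0 \<le> 9 * (c + 1) + 6" using c by simp
  ultimately show ?thesis
    unfolding competitive_on_def by blast
qed

end
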